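(* Let $D$ be an open set in the space $\mathbb{R}^4$ with coordinates $(a_0,a_1,a_2,a_3)$, with $a_3\neq 0$ on $D$, and write $\partial_i=\frac{\partial}{\partial a_i}$ for $i=0,1,2,3$. Assume that smooth functions $P,R,S,T$ of $(a_0,a_1,a_2,a_3)$ on $D$ satisfy the system of PDEs $$a_1\partial_0 P=2(2a_0-a_2)\,\partial_0 R+3(a_1-a_3)\,\partial_1 R+2(a_2-2)\,\partial_2 R+a_3\,\partial_3 R+R,$$ $$\partial_1 P=\partial_0 R,\qquad \partial_2 P=\partial_1 R,\qquad \partial_3 P=\partial_2 R,$$ $$\partial_0 S=\partial_1 R,\qquad \partial_1 S=\partial_2 R,\qquad \partial_2 S=\partial_3 R,$$ $$a_3\,\partial_3 S=a_1\,\partial_0 R+2(a_2-2a_0)\,\partial_1 R+3(a_3-a_1)\,\partial_2 R-2(a_2-2)\,\partial_3 R+P,$$ $$\partial_0 T=a_3\,\partial_2 R-2P,\qquad \partial_1 T=a_3\,\partial_3 R-2R,$$ $$\partial_2 T=a_1\,\partial_0 R+2(a_2-2a_0)\,\partial_1 R+3(a_3-a_1)\,\partial_2 R-2(a_2-2)\,\partial_3 R+P-2S,$$ $$a_3\,\partial_3 T=\gamma_0\,\partial_0 R+\gamma_1\,\partial_1 R+\gamma_2\,\partial_2 R+\gamma_3\,\partial_3 R+2(2-a_2)P+2a_3R,$$ where $$\gamma_0=2a_1(2-a_2),\qquad \gamma_1=-4a_2^2+8a_0a_2+a_1a_3-16a_0+8a_2,$$ $$\gamma_2=-4a_0a_3+6a_1a_2-4a_2a_3-12a_1+12a_3,\qquad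 \gamma_3=4(a_2-2)^2-3a_1a_3+3a_3^2.$$ Then any smooth solution $a_k(t,x)$, $k=0,1,2,3$ (defined on an open set of the $(t,x)$-plane and taking values in $D$), of the system of equations $$P=0,\qquad R=0,\qquad S=t,\qquad T=(4-2a_2)t-x$$ is also a solution of the quasi-linear system $$U_t+VU_x=0,\qquad U=(a_0,a_1,a_2,a_3)^T,\qquad V=\begin{pmatrix}0&0&0&a_1\\ a_3&0&0&2a_2-4a_0\\ 0&a_3&0&3a_3-3a_1\\ 0&0&a_3&4-2a_2\end{pmatrix}.$$
   Context: Subscripts $t$, $x$ denote partial derivatives. All functions are real-valued. *)

theory Defs
  imports "HOL-Analysis.Analysis"
begin

text \<open>
  Coordinates on \<open>\<real>\<^sup>4\<close> are indexed from 0: the index type \<open>4\<close> has exactly the elements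
  \<open>0, 1, 2, 3\<close>, so \<open>a $ k\<close> is the coordinate \<open>a\<^sub>k\<close>. (The library's \<open>vector\<close> and \<open>forall_4\<close>
  enumerate the same type as \<open>1, 2, 3, 4\<close> with \<open>4 = 0\<close>, so \<open>vector\<close> is not used here.)
\<close>

definition vec4 :: "'a \<Rightarrow> 'a \<Rightarrow> 'a \<Rightarrow> 'a \<Rightarrow> 'a ^ 4" where
  "vec4 x0 x1 x2 x3 =
     (\<chi> i. if i = 0 then x0 else if i = 1 then x1 else if i = 2 then x2 else x3)"

lemma vec4_nth [simp]:
  "vec4 x0 x1 x2 x3 $ 0 = x0" "vec4 x0 x1 x2 x3 $ 1 = x1"
  "vec4 x0 x1 x2 x3 $ 2 = x2" "vec4 x0 x1 x2 x3 $ 3 = x3"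
  by (simp_all add: vec4_def)

text \<open>
  Smoothness is meant for open \<open>S\<close>: all iterated directional derivatives of every order exist
  and are (Frechet differentiable, hence) continuous on \<open>S\<close>.
\<close>

primrec times_differentiable_on ::
  "nat \<Rightarrow> ('a::real_normed_vector \<Rightarrow> 'b::real_normed_vector) \<Rightarrow> 'a set \<Rightarrow> bool" where
  "times_differentiable_on 0 f S \<longleftrightarrow> continuous_on S f"
| "times_differentiable_on (Suc n) f S \<longleftrightarrow>
     (\<forall>x\<in>S. f differentiable (at x)) \<and>
     (\<forall>v. times_differentiable_on n (\<lambda>x. frechet_derivative f (at x) v) S)"

definition smooth_on :: "('a::real_normed_vector \<Rightarrow> 'b::real_normed_vector) \<Rightarrow> 'a set \<Rightarrow> bool" where
  "smooth_on f S \<longleftrightarrow> (\<forall>n. times_differentiable_on n f S)"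

definition pd :: "4 \<Rightarrow> (real ^ 4 \<Rightarrow> real) \<Rightarrow> real ^ 4 \<Rightarrow> real" where
  "pd i f a = deriv (\<lambda>s. f (\<chi> j. if j = i then s else a $ j)) (a $ i)"

definition dt :: "(real \<times> real \<Rightarrow> real ^ 4) \<Rightarrow> real \<times> real \<Rightarrow> real ^ 4" where
  "dt U = (\<lambda>(t, x). vector_derivative (\<lambda>s. U (s, x)) (at t))"

definition dx :: "(real \<times> real \<Rightarrow> real ^ 4) \<Rightarrow> real \<times> real \<Rightarrow> real ^ 4" where
  "dx U = (\<lambda>(t, x). vector_derivative (\<lambda>s. U (t, s)) (at x))"

definition PDE_system ::
  "(real ^ 4) set \<Rightarrow> (real ^ 4 \<Rightarrow> real) \<Rightarrow> (real ^ 4 \<Rightarrow> real) \<Rightarrow>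
   (real ^ 4 \<Rightarrow> real) \<Rightarrow> (real ^ 4 \<Rightarrow> real) \<Rightarrow> bool" where
  "PDE_system D P R S T \<longleftrightarrow> (\<forall>a\<in>D.
    (let a0 = a $ 0; a1 = a $ 1; a2 = a $ 2; a3 = a $ 3;
         g0 = 2 * a1 * (2 - a2);
         g1 = - 4 * a2^2 + 8 * a0 * a2 + a1 * a3 - 16 * a0 + 8 * a2;
         g2 = - 4 * a0 * a3 + 6 * a1 * a2 - 4 * a2 * a3 - 12 * a1 + 12 * a3;
         g3 = 4 * (a2 - 2)^2 - 3 * a1 * a3 + 3 * a3^2
     in
       a1 * pd 0 P a = 2 * (2 * a0 - a2) * pd 0 R a + 3 * (a1 - a3) * pd 1 R a
                       + 2 * (a2 - 2) * pd 2 R a + a3 * pd 3 R a + R a \<and>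
       pd 1 P a = pd 0 R a \<and> pd 2 P a = pd 1 R a \<and> pd 3 P a = pd 2 R a \<and>
       pd 0 S a = pd 1 R a \<and> pd 1 S a = pd 2 R a \<and> pd 2 S a = pd 3 R a \<and>
       a3 * pd 3 S a = a1 * pd 0 R a + 2 * (a2 - 2 * a0) * pd 1 R a
                       + 3 * (a3 - a1) * pd 2 R a - 2 * (a2 - 2) * pd 3 R a + P a \<and>
       pd 0 T a = a3 * pd 2 R a - 2 * P a \<and>
       pd 1 T a = a3 * pd 3 R a - 2 * R a \<and>
       pd 2 T a = a1 * pd 0 R a + 2 * (a2 - 2 * a0) * pd 1 R a
                  + 3 * (a3 - a1) * pd 2 R a - 2 * (a2 - 2) * pd 3 R a + P a - 2 * S a \<and>
       a3 * pd 3 T a = g0 * pd 0 R a + g1 * pd 1 R a + g2 * pd 2 R a + g3 * pd 3 R a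
                       + 2 * (2 - a2) * P a + 2 * a3 * R a))"

definition V :: "real ^ 4 \<Rightarrow> real ^ 4 ^ 4" where
  "V a = vec4
     (vec4 0 0 0 (a $ 1))
     (vec4 (a $ 3) 0 0 (2 * a $ 2 - 4 * a $ 0))
     (vec4 0 (a $ 3) 0 (3 * a $ 3 - 3 * a $ 1))
     (vec4 0 0 (a $ 3) (4 - 2 * a $ 2))"

end

theory Submission imports Defs begin

text \<open>
  At a point of the solution, \<open>P = R = 0\<close> and \<open>S = t\<close>, and the system of PDEs turns into a
  statement about the gradients alone. Put
  \<open>(h\<^sub>0, \<dots>, h\<^sub>6) = (\<partial>\<^sub>0P, \<partial>\<^sub>0R, \<partial>\<^sub>1R, \<partial>\<^sub>2R, \<partial>\<^sub>3R, \<partial>\<^sub>3S, \<partial>\<^sub>3T / a\<^sub>3)\<close>. The gradients of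
  \<open>P, R, S\<close> and of \<open>(T + 2ta\<^sub>2) / a\<^sub>3\<close>, with \<open>t\<close> held constant, are the rows of the Hankel
  matrix \<open>M = (h\<^sub>i\<^sub>+\<^sub>j)\<close>, and the remaining three equations, the lengthy coefficients \<open>\<gamma>\<^sub>i\<close>
  included, say that \<open>h\<close> satisfies the linear recurrence
  \<open>a\<^sub>3 h\<^sub>k\<^sub>+\<^sub>4 = c\<^sub>0 h\<^sub>k + c\<^sub>1 h\<^sub>k\<^sub>+\<^sub>1 + c\<^sub>2 h\<^sub>k\<^sub>+\<^sub>2 + c\<^sub>3 h\<^sub>k\<^sub>+\<^sub>3\<close>, where \<open>c\<close> is the last column of \<open>V\<close>.
  As \<open>V\<close> is a companion matrix up to scaling, multiplying a row of \<open>M\<close> by \<open>V\<close> yields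
  \<open>a\<^sub>3\<close> times the next row.

  Differentiating the four equations along the solution gives \<open>M U\<^sub>x = (0, 0, 0, - 1 / a\<^sub>3)\<close> and
  \<open>M U\<^sub>t = (0, 0, 1, c\<^sub>3 / a\<^sub>3)\<close>. Shifting the rows shows \<open>M V U\<^sub>x = - M U\<^sub>t\<close>, so
  \<open>M (U\<^sub>t + V U\<^sub>x) = 0\<close> (\<open>hankel_companion_flow\<close>).

  It remains to see that \<open>M\<close> is invertible, which is a consequence of the existence of the
  solution: the last unit vector lies in the range of \<open>M\<close>, and a Hankel matrix generated by a
  recurrence with this property has trivial kernel (\<open>hankel_kernel_trivial\<close>).
\<close>

section \<open>The chain rule in the coordinates of four-space\<close>

lemma UNIV_4_from_0: "(UNIV :: 4 set) = {0, 1, 2, 3}"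
proof -
  have "x \<in> {0, 1, 2, 3}" for x :: 4
    using exhaust_4[of x] by auto
  then show ?thesis by blast
qed

lemma sum_4_from_0: "(\<Sum>i\<in>(UNIV :: 4 set). f i) = f 0 + f 1 + f 2 + f 3"
  unfolding UNIV_4_from_0 by (simp add: add.assoc)

lemma all_4_from_0: "(\<forall>i :: 4. Q i) \<longleftrightarrow> Q 0 \<and> Q 1 \<and> Q 2 \<and> Q 3"
  by (metis (full_types) UNIV_4_from_0 UNIV_I empty_iff insert_iff)

lemma pd_eq_frechet_derivative:
  fixes f :: "real ^ 4 \<Rightarrow> real"
  assumes "f differentiable (at a)"
  shows "pd i f a = frechet_derivative f (at a) (axis i 1)"
proof -
  define g where "g s = (\<chi> j. if j = i then s else a $ j)" for s :: real
  have g: "g s = a + (s - a $ i) *\<^sub>R axis i 1" for s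
    by (simp add: g_def vec_eq_iff axis_def)
  have "(g has_vector_derivative axis i 1) (at (a $ i))"
    unfolding g by (auto intro!: derivative_eq_intros)
  moreover have "(f has_derivative frechet_derivative f (at a)) (at (g (a $ i)))"
    using assms by (simp add: g frechet_derivative_works)
  ultimately have "(f \<circ> g has_vector_derivative frechet_derivative f (at a) (axis i 1)) (at (a $ i))"
    by (meson vector_derivative_diff_chain_within has_derivative_at_withinI)
  then have "DERIV (\<lambda>s. f (g s)) (a $ i) :> frechet_derivative f (at a) (axis i 1)"
    by (simp add: has_real_derivative_iff_has_vector_derivative o_def)
  then show ?thesis unfolding pd_def g_def by (rule DERIV_imp_deriv)
qed

text \<open>
  The chain rule in the form in which an equation \<open>f (U (t, x)) = g (t, x)\<close> is differentiated in
  one variable with the other one fixed: the equation is known only on an open set, hence only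
  for parameters near \<open>s\<close>.
\<close>

lemma pd_along_curve:
  fixes f :: "real ^ 4 \<Rightarrow> real"
  assumes f: "f differentiable (at (c s))"
    and c: "(c has_vector_derivative w) (at s)"
    and g: "DERIV g s :> d"
    and eq: "\<forall>\<^sub>F r in nhds s. f (c r) = g r"
  shows "pd 0 f (c s) * w $ 0 + pd 1 f (c s) * w $ 1 + pd 2 f (c s) * w $ 2
           + pd 3 f (c s) * w $ 3 = d"
proof -
  let ?F = "frechet_derivative f (at (c s))"
  have F: "(f has_derivative ?F) (at (c s))"
    using f by (simp add: frechet_derivative_works)
  then have lin: "linear ?F" by (rule has_derivative_linear)
  have "(f \<circ> c has_vector_derivative ?F w) (at s)"
    using vector_derivative_diff_chain_within[OF c has_derivative_at_withinI[OF F]] by simp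
  then have "DERIV (\<lambda>r. f (c r)) s :> ?F w"
    by (simp add: has_real_derivative_iff_has_vector_derivative o_def)
  moreover have "DERIV (\<lambda>r. f (c r)) s :> d"
    using g DERIV_cong_ev[OF refl eq refl] by simp
  ultimately have "?F w = d" by (rule DERIV_unique)
  moreover have "?F w = (\<Sum>i\<in>UNIV. w $ i * ?F (axis i 1))"
    by (subst basis_expansion[symmetric, of w], subst linear_sum[OF lin])
       (simp add: linear_scale[OF lin] scalar_mult_eq_scaleR)
  ultimately show ?thesis
    by (simp add: sum_4_from_0 pd_eq_frechet_derivative[OF f] mult.commute)
qed

lemma smooth_on_imp_differentiable_at:
  assumes "smooth_on f S" "x \<in> S"
  shows "f differentiable (at x)"
  using assms unfolding smooth_on_def by (metis times_differentiable_on.simps(2))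

lemma has_vector_derivative_dt:
  assumes "U differentiable (at (t, x))"
  shows "((\<lambda>s. U (s, x)) has_vector_derivative dt U (t, x)) (at t)"
proof -
  have "((\<lambda>s. (s, x)) has_derivative (\<lambda>h. (h, 0))) (at t)"
    by (auto intro!: derivative_eq_intros)
  then have "(\<lambda>s. U (s, x)) differentiable (at t)"
    using differentiable_chain_at[of "\<lambda>s. (s, x)" t U] assms
    by (auto simp: o_def differentiable_def)
  then show ?thesis by (simp add: dt_def vector_derivative_works)
qed

lemma has_vector_derivative_dx:
  assumes "U differentiable (at (t, x))"
  shows "((\<lambda>s. U (t, s)) has_vector_derivative dx U (t, x)) (at x)"
proof -
  have "((\<lambda>s. (t, s)) has_derivative (\<lambda>h. (0, h))) (at x)"
    by (auto intro!: derivative_eq_intros)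
  then have "(\<lambda>s. U (t, s)) differentiable (at x)"
    using differentiable_chain_at[of "\<lambda>s. (t, s)" x U] assms
    by (auto simp: o_def differentiable_def)
  then show ?thesis by (simp add: dx_def vector_derivative_works)
qed

section \<open>Hankel matrices generated by a linear recurrence\<close>

text \<open>
  The hypothesis on \<open>v\<close> says that \<open>(h\<^sub>i\<^sub>+\<^sub>j)\<close> maps \<open>v\<close> to a nonzero multiple of the last unit
  vector. The matrix is symmetric, so pairing a kernel vector with \<open>v\<close> shows that its last
  entry vanishes. A kernel vector with last entry \<open>0\<close> may be shifted by one place and stays in
  the kernel: the rows move to the next ones, and the row which thereby leaves the matrix is by
  the recurrence a combination of the others. Repeated shifting brings every entry into the
  last place.
\<close>

lemma hankel_kernel_trivial:
  fixes h c v w :: "nat \<Rightarrow> 'a :: field"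
  assumes rec: "\<And>k. k < m \<Longrightarrow> h (Suc m + k) = (\<Sum>j<Suc m. c j * h (j + k))"
    and v: "\<And>i. i < Suc m \<Longrightarrow> (\<Sum>j<Suc m. h (i + j) * v j) = (if i = m then d else 0)"
    and d: "d \<noteq> 0"
    and w: "\<And>i. i < Suc m \<Longrightarrow> (\<Sum>j<Suc m. h (i + j) * w j) = 0"
    and k: "k \<le> m"
  shows "w k = 0"
proof -
  have last: "w m = 0"
    if w: "\<And>i. i < Suc m \<Longrightarrow> (\<Sum>j<Suc m. h (i + j) * w j) = 0" for w
  proof -
    have "0 = (\<Sum>i<Suc m. v i * (\<Sum>j<Suc m. h (i + j) * w j))"
      using w by (simp del: sum.lessThan_Suc)
    also have "\<dots> = (\<Sum>j<Suc m. w j * (\<Sum>i<Suc m. h (j + i) * v i))"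
      unfolding sum_distrib_left
      by (subst sum.swap) (simp add: mult_ac add_ac del: sum.lessThan_Suc)
    also have "\<dots> = (\<Sum>j<Suc m. w j * (if j = m then d else 0))"
      using v by (intro sum.cong) (auto simp del: sum.lessThan_Suc)
    also have "\<dots> = w m * d" by simp
    finally show ?thesis using d by simp
  qed
  have "w (m - n) = 0" if "n \<le> m" for n
    using that w
  proof (induction n arbitrary: w)
    case 0
    then show ?case using last by (simp del: sum.lessThan_Suc)
  next
    case (Suc n)
    define w' where "w' = case_nat 0 w"
    have w0: "w m = 0" by (rule last) (rule Suc.prems(2))
    have row: "(\<Sum>j<m. h (i + j) * w j) = 0" if "i < Suc m" for i
      using Suc.prems(2)[OF that] w0 by simp
    have "(\<Sum>j<Suc m. h (i + j) * w' j) = 0" if "i < Suc m" for i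
    proof -
      have shift: "(\<Sum>j<Suc m. h (i + j) * w' j) = (\<Sum>j<m. h (Suc i + j) * w j)"
        by (subst sum.lessThan_Suc_shift) (simp add: w'_def)
      show ?thesis
      proof (cases "i = m")
        case True
        have "(\<Sum>j<m. h (Suc m + j) * w j) = (\<Sum>j<m. (\<Sum>l<Suc m. c l * h (l + j)) * w j)"
          using rec by (intro sum.cong) (auto simp del: sum.lessThan_Suc)
        also have "\<dots> = (\<Sum>l<Suc m. c l * (\<Sum>j<m. h (l + j) * w j))"
          unfolding sum_distrib_left sum_distrib_right
          by (subst sum.swap) (simp add: mult_ac del: sum.lessThan_Suc)
        also have "\<dots> = 0" using row by (intro sum.neutral) (auto simp del: sum.lessThan_Suc)
        finally show ?thesis using shift True by (simp del: sum.lessThan_Suc)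
      next
        case False
        then show ?thesis using shift row[of "Suc i"] that by (simp del: sum.lessThan_Suc)
      qed
    qed
    then have "w' (m - n) = 0" using Suc.IH[of w'] Suc.prems(1) by (simp del: sum.lessThan_Suc)
    moreover have "m - n = Suc (m - Suc n)" using Suc.prems(1) by simp
    ultimately show ?case by (simp add: w'_def)
  qed
  from this[of "m - k"] k show ?thesis by simp
qed

text \<open>
  The parenthesis in the conclusion is the \<open>k\<close>-th entry of \<open>V v\<close>, where \<open>V\<close> is the companion
  matrix with \<open>b\<close> below the diagonal and last column \<open>c\<close>; thus the conclusion is
  \<open>u + V v = 0\<close>. The data for \<open>u\<close> are exactly minus the data which the recurrence yields for
  \<open>V v\<close>, so \<open>u + V v\<close> lies in the kernel of the Hankel matrix.
\<close>

lemma hankel_companion_flow: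
  fixes h c u v :: "nat \<Rightarrow> 'a :: field"
  assumes b: "b \<noteq> 0"
    and rec: "\<And>k. k \<le> m \<Longrightarrow> b * h (Suc m + k) = (\<Sum>j<Suc m. c j * h (j + k))"
    and v: "\<And>i. i \<le> m \<Longrightarrow> (\<Sum>j<Suc m. h (i + j) * v j) = (if i = m then - 1 / b else 0)"
    and u: "\<And>i. i \<le> m \<Longrightarrow>
      (\<Sum>j<Suc m. h (i + j) * u j) = (if i = m then c m / b else if Suc i = m then 1 else 0)"
    and k: "k \<le> m"
  shows "u k + ((case k of 0 \<Rightarrow> 0 | Suc j \<Rightarrow> b * v j) + c k * v m) = 0"
proof -
  define s where "s k = (case k of 0 \<Rightarrow> 0 | Suc j \<Rightarrow> b * v j)" for k
  \<comment> \<open>For \<open>i = m\<close> this is the row just below the matrix, and by the recurrence only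
    the term \<open>c m\<close> survives.\<close>
  have next_v: "b * (\<Sum>j<Suc m. h (Suc i + j) * v j)
      = - (if i = m then c m / b else if Suc i = m then 1 else 0)" if "i \<le> m" for i
  proof (cases "i = m")
    case True
    have "b * (\<Sum>j<Suc m. h (Suc m + j) * v j) = (\<Sum>j<Suc m. (b * h (Suc m + j)) * v j)"
      unfolding sum_distrib_left by (simp add: mult_ac del: sum.lessThan_Suc)
    also have "\<dots> = (\<Sum>j<Suc m. (\<Sum>l<Suc m. c l * h (l + j)) * v j)"
      using rec by (intro sum.cong) (auto simp del: sum.lessThan_Suc)
    also have "\<dots> = (\<Sum>l<Suc m. c l * (\<Sum>j<Suc m. h (l + j) * v j))"
      unfolding sum_distrib_left sum_distrib_right
      by (subst sum.swap) (simp add: mult_ac del: sum.lessThan_Suc)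
    also have "\<dots> = (\<Sum>l<Suc m. c l * (if l = m then - 1 / b else 0))"
      using v by (intro sum.cong) (auto simp del: sum.lessThan_Suc)
    also have "\<dots> = - (c m / b)" by simp
    finally show ?thesis using True by (simp del: sum.lessThan_Suc)
  next
    case False
    then show ?thesis using v[of "Suc i"] that b by (simp del: sum.lessThan_Suc)
  qed
  have kernel: "(\<Sum>j<Suc m. h (i + j) * (u j + (s j + c j * v m))) = 0" if "i < Suc m" for i
  proof -
    have "(\<Sum>j<Suc m. h (i + j) * s j) = b * (\<Sum>j<m. h (Suc i + j) * v j)"
      by (subst sum.lessThan_Suc_shift) (simp add: s_def sum_distrib_left mult_ac)
    moreover have "(\<Sum>j<Suc m. h (i + j) * (c j * v m)) = b * (h (Suc i + m) * v m)"
    proof -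
      have "(\<Sum>j<Suc m. h (i + j) * (c j * v m)) = (\<Sum>j<Suc m. c j * h (j + i)) * v m"
        unfolding sum_distrib_right by (simp add: mult_ac add_ac del: sum.lessThan_Suc)
      then show ?thesis using rec[of i] that by (simp add: add_ac mult_ac del: sum.lessThan_Suc)
    qed
    ultimately have "(\<Sum>j<Suc m. h (i + j) * (u j + (s j + c j * v m)))
        = (\<Sum>j<Suc m. h (i + j) * u j) + b * (\<Sum>j<Suc m. h (Suc i + j) * v j)"
      unfolding distrib_left sum.distrib by (simp add: algebra_simps)
    then show ?thesis using u[of i] next_v[of i] that by (simp del: sum.lessThan_Suc)
  qed
  have "u k + (s k + c k * v m) = 0"
  proof (rule hankel_kernel_trivial[where h = h and m = m and v = v and d = "- 1 / b"
        and c = "\<lambda>j. c j / b" and w = "\<lambda>k. u k + (s k + c k * v m)"])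
    show "h (Suc m + k) = (\<Sum>j<Suc m. c j / b * h (j + k))" if "k < m" for k
    proof -
      have "h (Suc m + k) = (\<Sum>j<Suc m. c j * h (j + k)) / b"
        using rec[of k] that b by (simp add: field_simps del: sum.lessThan_Suc)
      then show ?thesis by (simp add: sum_divide_distrib del: sum.lessThan_Suc)
    qed
  qed (use v kernel b k in \<open>auto simp del: sum.lessThan_Suc\<close>)
  then show ?thesis by (simp add: s_def)
qed

section \<open>Solutions of the algebraic equations solve the quasi-linear system\<close>

theorem theorem9:
  fixes D :: "(real ^ 4) set"
    and P R S T :: "real ^ 4 \<Rightarrow> real"
    and W :: "(real \<times> real) set"
    and U :: "real \<times> real \<Rightarrow> real ^ 4"
  assumes "open D"
    and "\<And>a. a \<in> D \<Longrightarrow> a $ 3 \<noteq> 0"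
    and "smooth_on P D" "smooth_on R D" "smooth_on S D" "smooth_on T D"
    and "PDE_system D P R S T"
    and "open W"
    and "smooth_on U W"
    and "\<And>t x. (t, x) \<in> W \<Longrightarrow> U (t, x) \<in> D"
    and "\<And>t x. (t, x) \<in> W \<Longrightarrow>
           P (U (t, x)) = 0 \<and> R (U (t, x)) = 0 \<and> S (U (t, x)) = t \<and>
           T (U (t, x)) = (4 - 2 * U (t, x) $ 2) * t - x"
  shows "\<forall>(t, x)\<in>W. dt U (t, x) + V (U (t, x)) *v dx U (t, x) = 0"
proof clarify
  fix t x assume tx: "(t, x) \<in> W"
  define a where "a = U (t, x)"
  define u where "u = dt U (t, x)"
  define v where "v = dx U (t, x)"
  have aD: "a \<in> D" using assms(10)[OF tx] by (simp add: a_def)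
  have a3: "a $ 3 \<noteq> 0" using assms(2)[OF aD] .
  have sol: "P a = 0" "R a = 0" "S a = t" using assms(11)[OF tx] by (auto simp: a_def)
  have diff: "P differentiable (at a)" "R differentiable (at a)"
    "S differentiable (at a)" "T differentiable (at a)"
    using assms(3-6) aD by (auto intro: smooth_on_imp_differentiable_at)
  have dU: "U differentiable (at (t, x))"
    using assms(9) tx by (rule smooth_on_imp_differentiable_at)
  have ct: "((\<lambda>s. U (s, x)) has_vector_derivative u) (at t)"
    and cx: "((\<lambda>s. U (t, s)) has_vector_derivative v) (at x)"
    unfolding u_def v_def by (rule has_vector_derivative_dt[OF dU] has_vector_derivative_dx[OF dU])+
  have near_t: "\<forall>\<^sub>F s in nhds t. (s, x) \<in> W"
    using topological_tendstoD[OF _ assms(8) tx, of "\<lambda>s. (s, x)" "nhds t"]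
    by (simp add: tendsto_Pair filterlim_ident)
  have near_x: "\<forall>\<^sub>F s in nhds x. (t, s) \<in> W"
    using topological_tendstoD[OF _ assms(8) tx, of "\<lambda>s. (t, s)" "nhds x"]
    by (simp add: tendsto_Pair filterlim_ident)
  have coord: "DERIV (\<lambda>s. U (s, x) $ 2) t :> u $ 2" "DERIV (\<lambda>s. U (t, s) $ 2) x :> v $ 2"
    using bounded_linear.has_vector_derivative[OF bounded_linear_vec_nth ct]
      bounded_linear.has_vector_derivative[OF bounded_linear_vec_nth cx]
    by (simp_all add: has_real_derivative_iff_has_vector_derivative)
  note along_t = pd_along_curve[where c = "\<lambda>s. U (s, x)" and s = t, folded a_def, OF _ ct]
  note along_x = pd_along_curve[where c = "\<lambda>s. U (t, s)" and s = x, folded a_def, OF _ cx]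

  have Pt: "pd 0 P a * u $ 0 + pd 1 P a * u $ 1 + pd 2 P a * u $ 2 + pd 3 P a * u $ 3 = 0"
    by (rule along_t[OF diff(1) DERIV_const]) (use near_t assms(11) in \<open>auto elim: eventually_mono\<close>)
  have Px: "pd 0 P a * v $ 0 + pd 1 P a * v $ 1 + pd 2 P a * v $ 2 + pd 3 P a * v $ 3 = 0"
    by (rule along_x[OF diff(1) DERIV_const]) (use near_x assms(11) in \<open>auto elim: eventually_mono\<close>)
  have Rt: "pd 0 R a * u $ 0 + pd 1 R a * u $ 1 + pd 2 R a * u $ 2 + pd 3 R a * u $ 3 = 0"
    by (rule along_t[OF diff(2) DERIV_const]) (use near_t assms(11) in \<open>auto elim: eventually_mono\<close>)
  have Rx: "pd 0 R a * v $ 0 + pd 1 R a * v $ 1 + pd 2 R a * v $ 2 + pd 3 R a * v $ 3 = 0"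
    by (rule along_x[OF diff(2) DERIV_const]) (use near_x assms(11) in \<open>auto elim: eventually_mono\<close>)
  have St: "pd 0 S a * u $ 0 + pd 1 S a * u $ 1 + pd 2 S a * u $ 2 + pd 3 S a * u $ 3 = 1"
    by (rule along_t[OF diff(3) DERIV_ident]) (use near_t assms(11) in \<open>auto elim: eventually_mono\<close>)
  have Sx: "pd 0 S a * v $ 0 + pd 1 S a * v $ 1 + pd 2 S a * v $ 2 + pd 3 S a * v $ 3 = 0"
    by (rule along_x[OF diff(3) DERIV_const]) (use near_x assms(11) in \<open>auto elim: eventually_mono\<close>)
  have Tt: "pd 0 T a * u $ 0 + pd 1 T a * u $ 1 + pd 2 T a * u $ 2 + pd 3 T a * u $ 3
      = 4 - 2 * a $ 2 - 2 * t * u $ 2"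
  proof (rule along_t[OF diff(4)])
    show "DERIV (\<lambda>s. (4 - 2 * U (s, x) $ 2) * s - x) t :> 4 - 2 * a $ 2 - 2 * t * u $ 2"
      by (auto intro!: derivative_eq_intros coord simp: a_def)
  qed (use near_t assms(11) in \<open>auto elim: eventually_mono\<close>)
  have Tx: "pd 0 T a * v $ 0 + pd 1 T a * v $ 1 + pd 2 T a * v $ 2 + pd 3 T a * v $ 3
      = - 1 - 2 * t * v $ 2"
  proof (rule along_x[OF diff(4)])
    show "DERIV (\<lambda>s. (4 - 2 * U (t, s) $ 2) * t - s) x :> - 1 - 2 * t * v $ 2"
      by (auto intro!: derivative_eq_intros coord)
  qed (use near_x assms(11) in \<open>auto elim: eventually_mono\<close>)

  define b where "b = a $ 3"
  have b: "b \<noteq> 0" using a3 by (simp add: b_def)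
  define c where "c = (!) [a $ 1, 2 * a $ 2 - 4 * a $ 0, 3 * b - 3 * a $ 1, 4 - 2 * a $ 2]"
  \<comment> \<open>The entries \<open>h 0, \<dots>, h 6\<close> fill the Hankel matrix. The entry \<open>h 7\<close> is no derivative; it
    is chosen such that the recurrence also holds one step further, which provides the row
    below the matrix.\<close>
  define hs where "hs = [pd 0 P a, pd 0 R a, pd 1 R a, pd 2 R a, pd 3 R a, pd 3 S a, pd 3 T a / b]"
  define h where "h = (!) (hs @ [(\<Sum>j<4. c j * hs ! (j + 3)) / b])"
  have h_nth: "h 0 = pd 0 P a" "h 1 = pd 0 R a" "h 2 = pd 1 R a" "h 3 = pd 2 R a"
    "h 4 = pd 3 R a" "h 5 = pd 3 S a" "h 6 = pd 3 T a / b"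
    by (simp_all add: h_def hs_def)
  have c_nth: "c 0 = a $ 1" "c 1 = 2 * a $ 2 - 4 * a $ 0" "c 2 = 3 * b - 3 * a $ 1"
    "c 3 = 4 - 2 * a $ 2"
    by (simp_all add: c_def)
  have h7: "h 7 = (c 0 * h 3 + c 1 * h 4 + c 2 * h 5 + c 3 * h 6) / b"
    by (simp add: h_def hs_def eval_nat_numeral)
  have sum4: "(\<Sum>j<Suc 3. f j) = f 0 + f 1 + f 2 + f 3" for f :: "nat \<Rightarrow> real"
    by (simp add: eval_nat_numeral)
  have le3: "k \<le> 3 \<longleftrightarrow> k = 0 \<or> k = 1 \<or> k = 2 \<or> k = 3" for k :: nat by auto
  have system: "a $ 1 * h 0 = 2 * (2 * a $ 0 - a $ 2) * h 1 + 3 * (a $ 1 - b) * h 2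
        + 2 * (a $ 2 - 2) * h 3 + b * h 4"
    "pd 1 P a = h 1" "pd 2 P a = h 2" "pd 3 P a = h 3"
    "pd 0 S a = h 2" "pd 1 S a = h 3" "pd 2 S a = h 4"
    "b * h 5 = a $ 1 * h 1 + 2 * (a $ 2 - 2 * a $ 0) * h 2 + 3 * (b - a $ 1) * h 3
        - 2 * (a $ 2 - 2) * h 4"
    "pd 0 T a = b * h 3" "pd 1 T a = b * h 4" "pd 2 T a = b * h 5 - 2 * t"
    "b * (b * h 6) = 2 * a $ 1 * (2 - a $ 2) * h 1
        + (- 4 * (a $ 2)^2 + 8 * a $ 0 * a $ 2 + a $ 1 * b - 16 * a $ 0 + 8 * a $ 2) * h 2
        + (- 4 * a $ 0 * b + 6 * a $ 1 * a $ 2 - 4 * a $ 2 * b - 12 * a $ 1 + 12 * b) * h 3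
        + (4 * (a $ 2 - 2)^2 - 3 * a $ 1 * b + 3 * b^2) * h 4"
    using assms(7)[unfolded PDE_system_def Let_def, rule_format, OF aD, unfolded sol] b
    unfolding h_nth b_def by simp_all
  have rec: "b * h (Suc 3 + k) = (\<Sum>j<Suc 3. c j * h (j + k))" if "k \<le> 3" for k
  proof -
    have "b * h 4 = c 0 * h 0 + c 1 * h 1 + c 2 * h 2 + c 3 * h 3"
      using system(1) unfolding c_nth by (simp add: algebra_simps)
    moreover have h5: "b * h 5 = c 0 * h 1 + c 1 * h 2 + c 2 * h 3 + c 3 * h 4"
      using system(8) unfolding c_nth by (simp add: algebra_simps)
    \<comment> \<open>The coefficients \<open>\<gamma>\<^sub>i\<close> arise from this recurrence on multiplying by \<open>a\<^sub>3\<close> and eliminating \<open>h 5\<close>.\<close>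
    moreover have "b * h 6 = c 0 * h 2 + c 1 * h 3 + c 2 * h 4 + c 3 * h 5"
    proof -
      have "b * (b * h 6) = b * (c 0 * h 2 + c 1 * h 3 + c 2 * h 4) + c 3 * (b * h 5)"
        unfolding system(12) h5 c_nth by (simp add: algebra_simps power2_eq_square)
      then have "b * (b * h 6) = b * (c 0 * h 2 + c 1 * h 3 + c 2 * h 4 + c 3 * h 5)"
        by (simp add: algebra_simps)
      then show ?thesis using b by simp
    qed
    moreover have "b * h 7 = c 0 * h 3 + c 1 * h 4 + c 2 * h 5 + c 3 * h 6"
      using b by (simp add: h7)
    ultimately show ?thesis using that unfolding le3 sum4 by (auto simp: eval_nat_numeral)
  qed
  \<comment> \<open>The vectors are re-indexed by natural numbers, as the shifts of indices require.\<close>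
  define u' where "u' = (!) [u $ 0, u $ 1, u $ 2, u $ 3]"
  define v' where "v' = (!) [v $ 0, v $ 1, v $ 2, v $ 3]"
  have u'_nth: "u' 0 = u $ 0" "u' 1 = u $ 1" "u' 2 = u $ 2" "u' 3 = u $ 3"
    and v'_nth: "v' 0 = v $ 0" "v' 1 = v $ 1" "v' 2 = v $ 2" "v' 3 = v $ 3"
    by (simp_all add: u'_def v'_def)
  have rows_v: "(\<Sum>j<Suc 3. h (i + j) * v' j) = (if i = 3 then - 1 / b else 0)" if "i \<le> 3" for i
  proof -
    have "b * (h 3 * v $ 0 + h 4 * v $ 1 + h 5 * v $ 2 + h 6 * v $ 3) = - 1"
      using Tx b unfolding system h_nth by (simp add: algebra_simps)
    then have "h 3 * v $ 0 + h 4 * v $ 1 + h 5 * v $ 2 + h 6 * v $ 3 = - 1 / b"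
      using b by (simp add: field_simps)
    then show ?thesis
      using that Px[unfolded system] Rx Sx[unfolded system]
      unfolding le3 sum4 v'_nth by (auto simp: h_def hs_def eval_nat_numeral)
  qed
  have rows_u: "(\<Sum>j<Suc 3. h (i + j) * u' j)
      = (if i = 3 then c 3 / b else if Suc i = 3 then 1 else 0)" if "i \<le> 3" for i
  proof -
    have "b * (h 3 * u $ 0 + h 4 * u $ 1 + h 5 * u $ 2 + h 6 * u $ 3) = c 3"
      using Tt b unfolding system h_nth c_nth by (simp add: algebra_simps)
    then have "h 3 * u $ 0 + h 4 * u $ 1 + h 5 * u $ 2 + h 6 * u $ 3 = c 3 / b"
      using b by (simp add: field_simps)
    then show ?thesis
      using that Pt[unfolded system] Rt St[unfolded system]
      unfolding le3 sum4 u'_nth by (auto simp: h_def hs_def eval_nat_numeral)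
  qed
  have flow: "u' k + ((case k of 0 \<Rightarrow> 0 | Suc j \<Rightarrow> b * v' j) + c k * v' 3) = 0" if "k \<le> 3" for k
    using hankel_companion_flow[OF b rec rows_v rows_u that] .
  have "u + V a *v v = 0"
    using flow[of 0] flow[of 1] flow[of 2] flow[of 3]
    by (simp add: vec_eq_iff all_4_from_0 matrix_vector_mult_def sum_4_from_0 V_def
        u'_def v'_def c_def b_def eval_nat_numeral)
  then show "dt U (t, x) + V (U (t, x)) *v dx U (t, x) = 0"
    by (simp add: u_def v_def a_def)
qed

end
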